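(* For $n\ge 1$, let $X$ be a set of cardinality $n$. The number of elements of $\mathcal{F}_{2,1}(X)$, counted up to isomorphism, is the $n$-th Schröder number (the $n$-th term, $n=1,2,3,\ldots$, of the sequence of large Schröder numbers $1,2,6,22,90,\ldots$).
   Context: For a finite set $X$, let $\mathcal{D}=\{(x,x)\mid x\in X\}$; for a binary relation $\theta$ on $X$ let $\overline{\theta}=\theta\cup\theta^{-1}$; for binary relations $A,B$ on $X$, $A\circ B=\{(x,z)\mid \exists y\in X:\ xAy \text{ and } yBz\}$, and $A^h$ is the $h$-fold composition of $A$ with itself. $\mathcal{F}_{h,k}(X)$ ($h,k\ge1$) is the class of all pairs $(S,R)$ of binary relations on $X$ such that: $S$ and $R$ are strict order relations (irreflexive and transitive); $\overline{R}\cup\overline{S}=X^2\setminus\mathcal{D}$; $\overline{R}\cap\overline{S}=\emptyset$; and $S^h\circ R^k\subseteq R$. Two pairs $(S_1,R_1)$ on $X_1$ and $(S_2,R_2)$ on $X_2$ are isomorphic if there is a bijection $\xi:X_1\to X_2$ with $xS_1y\iff\xi(x)S_2\xi(y)$ and $xR_1y\iff\xi(x)R_2\xi(y)$. Large Schröder numbers: $r_m$ is the number of lattice paths from $(0,0)$ to $(2m,0)$ with steps $(1,1)$, $(1,-1)$, $(2,0)$ remaining weakly above the $x$-axis, so $r_0,r_1,r_2,\ldots=1,2,6,22,90,\ldots$; the $n$-th Schröder number in the claim is $r_{n-1}$. *)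

theory Defs
  imports Main "HOL-Library.Product_Plus"
begin

definition sym_closure :: "'a rel \<Rightarrow> 'a rel"
  where "sym_closure T = T \<union> T\<inverse>"

definition strict_order_on :: "'a set \<Rightarrow> 'a rel \<Rightarrow> bool"
  where "strict_order_on X T \<longleftrightarrow> T \<subseteq> X \<times> X \<and> irrefl T \<and> trans T"

(* Relation composition O has the left factor first. The indices are meant to be at least 1
   (for h = 0 the relation power would be the identity on the whole type, not on X). *)
definition order_pairs :: "nat \<Rightarrow> nat \<Rightarrow> 'a set \<Rightarrow> ('a rel \<times> 'a rel) set"
  where "order_pairs h k X = {(S, R).
    strict_order_on X S \<and> strict_order_on X R \<and>
    sym_closure R \<union> sym_closure S = X \<times> X - Id_on X \<and>
    sym_closure R \<inter> sym_closure S = {} \<and>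
    (S ^^ h) O (R ^^ k) \<subseteq> R}"

definition pair_isomorphic ::
    "'a set \<Rightarrow> 'a rel \<times> 'a rel \<Rightarrow> 'b set \<Rightarrow> 'b rel \<times> 'b rel \<Rightarrow> bool"
  where "pair_isomorphic X P Y Q \<longleftrightarrow> (\<exists>\<xi>. bij_betw \<xi> X Y \<and>
    (\<forall>x\<in>X. \<forall>y\<in>X. (x, y) \<in> fst P \<longleftrightarrow> (\<xi> x, \<xi> y) \<in> fst Q) \<and>
    (\<forall>x\<in>X. \<forall>y\<in>X. (x, y) \<in> snd P \<longleftrightarrow> (\<xi> x, \<xi> y) \<in> snd Q))"

definition order_pairs_iso :: "nat \<Rightarrow> nat \<Rightarrow> 'a set \<Rightarrow> ('a rel \<times> 'a rel) rel"
  where "order_pairs_iso h k X = {(P, Q).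
    P \<in> order_pairs h k X \<and> Q \<in> order_pairs h k X \<and> pair_isomorphic X P X Q}"

(* A path starting at the origin is the list of its steps; sum_list (take i p) is the point
   reached after i steps. On the straight step segments the height is monotone, so it is enough
   to require that these points are weakly above the axis. *)
definition schroeder_paths :: "nat \<Rightarrow> (int \<times> int) list set"
  where "schroeder_paths m = {p.
    set p \<subseteq> {(1, 1), (1, - 1), (2, 0)} \<and>
    sum_list p = (2 * int m, 0) \<and>
    (\<forall>i\<le>length p. 0 \<le> snd (sum_list (take i p)))}"

definition large_schroeder :: "nat \<Rightarrow> nat"
  where "large_schroeder m = card (schroeder_paths m)"

end

theory Submission
  imports Defs
begin

text \<open>
  Call a pair \<open>(S, R)\<close> complementary if \<open>S\<close> and \<open>R\<close> are strict orders that compare disjoint sets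
  of pairs and together compare everything. Then both \<open>S \<union> R\<close> and \<open>S \<union> R\<inverse>\<close> are linear
  orders, and conversely \<open>S\<close> and \<open>R\<close> are where the two linear orders agree and disagree. So,
  up to isomorphism, complementary pairs on \<open>n\<close> points are permutations of \<open>n\<close>. The inclusion
  \<open>S\<^sup>2 \<circ> R \<subseteq> R\<close> fails exactly if there are \<open>a S b S c R d\<close> with \<open>a S d\<close>, and with both linear
  orders read downwards this says that the permutation contains 3124 or 2134, at the places of
  \<open>d\<close>, \<open>c\<close>, \<open>b\<close>, \<open>a\<close>. Hence the isomorphism classes correspond bijectively to the permutations
  that avoid these two patterns (\<open>perm_pair_in_order_pairs\<close>, \<open>perm_pair_iso_imp_eq\<close>,
  \<open>order_pairs_iso_perm_pair\<close>).

  These permutations are generated by inserting the maximum. The insertion is admissible if and only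
  if the entries before the maximum have no valley, i.e. rise and then fall
  (\<open>avoids_patterns_insert_at\<close>). Give a permutation the label \<open>h\<close> if its longest valley-free prefix
  has length \<open>h + 1\<close>. It then has \<open>h + 2\<close> children, and their labels are \<open>1, ..., h, h + 1, h + 1\<close>
  (\<open>sum_hill_run_insert_at\<close>). So the permutations of \<open>n + 1\<close> elements are the nodes at depth \<open>n\<close> of
  the tree with this succession rule and root 0.

  It remains to count these nodes. The numbers \<open>t d h\<close> of nodes \<open>d\<close> levels below a label \<open>h\<close> and the
  numbers \<open>p c h\<close> of ways to finish a Schroeder path from height \<open>h\<close> with \<open>c\<close> more up or flat steps
  both satisfy simple recursions, from which an induction gives that \<open>2 ^ h * t d h\<close> is the binomial
  transform of \<open>p d\<close> at \<open>h\<close> (\<open>tree_count_binomial_transform\<close>). For \<open>h = 0\<close> both numbers agree.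
\<close>

section \<open>Lattice paths and the Schroeder generating tree\<close>

text \<open>\<open>path_tail_count c h\<close> counts the ways to complete a path from height \<open>h\<close> down to the axis with
  exactly \<open>c\<close> further up or flat steps; the equations split off the next step. This number of steps
  and the height determine the horizontal distance that remains.\<close>

fun path_tail_count :: "nat \<Rightarrow> nat \<Rightarrow> nat" where
  "path_tail_count 0 0 = 1"
| "path_tail_count 0 (Suc h) = path_tail_count 0 h"
| "path_tail_count (Suc c) 0 = path_tail_count c 1 + path_tail_count c 0"
| "path_tail_count (Suc c) (Suc h) =
     path_tail_count (Suc c) h + (path_tail_count c (Suc (Suc h)) + path_tail_count c (Suc h))"

definition path_tails :: "nat \<Rightarrow> nat \<Rightarrow> (int \<times> int) list set" where
  "path_tails c h = {p.
    set p \<subseteq> {(1, 1), (1, - 1), (2, 0)} \<and>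
    sum_list p = (2 * int c + int h, - int h) \<and>
    (\<forall>i\<le>length p. 0 \<le> int h + snd (sum_list (take i p)))}"

lemma all_le_Suc_split: "(\<forall>i\<le>Suc n. P i) \<longleftrightarrow> P 0 \<and> (\<forall>i\<le>n. P (Suc i))"
  using All_less_Suc2[of "Suc n" P] by (simp add: less_Suc_eq_le)

text \<open>Every step moves right at least as far as it moves down. Hence a tail without up and flat
  steps has no room for one.\<close>

lemma sum_list_steps_nonneg:
  assumes "set p \<subseteq> {(1, 1), (1, - 1), (2, 0)}"
  shows "0 \<le> fst (sum_list p) + snd (sum_list p :: int \<times> int)"
  using assms by (induction p) auto

lemma path_tails_up: "(1, 1) # p \<in> path_tails c h \<longleftrightarrow> (\<exists>d. c = Suc d \<and> p \<in> path_tails d (Suc h))"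
proof (cases c)
  case 0
  have "(1, 1) # p \<notin> path_tails 0 h"
  proof
    assume "(1, 1) # p \<in> path_tails 0 h"
    then have st: "set p \<subseteq> {(1, 1), (1, - 1), (2, 0)}"
      and s: "sum_list p = (int h - 1, - int h - 1)"
      by (auto simp: path_tails_def prod_eq_iff)
    show False
      using sum_list_steps_nonneg[OF st] s by simp
  qed
  then show ?thesis using 0 by simp
next
  case (Suc d)
  show ?thesis
    by (auto simp: Suc path_tails_def all_le_Suc_split prod_eq_iff algebra_simps)
qed

lemma path_tails_flat: "(2, 0) # p \<in> path_tails c h \<longleftrightarrow> (\<exists>d. c = Suc d \<and> p \<in> path_tails d h)"
proof (cases c)
  case 0
  have "(2, 0) # p \<notin> path_tails 0 h"
  proof
    assume "(2, 0) # p \<in> path_tails 0 h"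
    then have st: "set p \<subseteq> {(1, 1), (1, - 1), (2, 0)}"
      and s: "sum_list p = (int h - 2, - int h)"
      by (auto simp: path_tails_def prod_eq_iff)
    show False
      using sum_list_steps_nonneg[OF st] s by simp
  qed
  then show ?thesis using 0 by simp
next
  case (Suc d)
  show ?thesis
    by (auto simp: Suc path_tails_def all_le_Suc_split prod_eq_iff algebra_simps)
qed

lemma path_tails_down: "(1, - 1) # p \<in> path_tails c h \<longleftrightarrow> (\<exists>g. h = Suc g \<and> p \<in> path_tails c g)"
proof (cases h)
  case 0
  then show ?thesis
    by (auto simp: path_tails_def all_le_Suc_split prod_eq_iff)
next
  case (Suc g)
  show ?thesis
    by (auto simp: Suc path_tails_def all_le_Suc_split prod_eq_iff algebra_simps)
qed

lemma path_tails_Nil: "[] \<in> path_tails c h \<longleftrightarrow> c = 0 \<and> h = 0"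
  by (auto simp: path_tails_def prod_eq_iff)

lemma path_tails_Cons:
  "x # p \<in> path_tails c h \<longleftrightarrow>
    x = (1, 1) \<and> (\<exists>d. c = Suc d \<and> p \<in> path_tails d (Suc h)) \<or>
    x = (2, 0) \<and> (\<exists>d. c = Suc d \<and> p \<in> path_tails d h) \<or>
    x = (1, - 1) \<and> (\<exists>g. h = Suc g \<and> p \<in> path_tails c g)"
proof -
  consider "x = (1, 1)" | "x = (2, 0)" | "x = (1, - 1)" | "x \<notin> {(1, 1), (1, - 1), (2, 0)}"
    by blast
  then show ?thesis
  proof cases
    case 4
    then show ?thesis by (simp add: path_tails_def)
  qed (simp_all add: path_tails_up path_tails_flat path_tails_down)
qed

lemma finite_card_path_tails: "finite (path_tails c h) \<and> card (path_tails c h) = path_tail_count c h"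
proof (induction c h rule: path_tail_count.induct)
  case 1
  have "p \<in> path_tails 0 0 \<longleftrightarrow> p = []" for p
    by (cases p) (auto simp: path_tails_Nil path_tails_Cons)
  then have "path_tails 0 0 = {[]}" by blast
  then show ?case by simp
next
  case (2 h)
  have "p \<in> path_tails 0 (Suc h) \<longleftrightarrow> p \<in> Cons (1, - 1) ` path_tails 0 h" for p
    by (cases p) (auto simp: path_tails_Nil path_tails_Cons)
  then have "path_tails 0 (Suc h) = Cons (1, - 1) ` path_tails 0 h" by blast
  then show ?case using 2 by (simp add: card_image)
next
  case (3 c)
  have "p \<in> path_tails (Suc c) 0 \<longleftrightarrow>
      p \<in> Cons (1, 1) ` path_tails c 1 \<union> Cons (2, 0) ` path_tails c 0" for p
    by (cases p) (auto simp: path_tails_Nil path_tails_Cons)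
  then have "path_tails (Suc c) 0 = Cons (1, 1) ` path_tails c 1 \<union> Cons (2, 0) ` path_tails c 0"
    by blast
  moreover have "Cons (1, 1) ` path_tails c 1 \<inter> Cons (2, 0) ` path_tails c 0 = {}"
    by auto
  ultimately show ?case using 3 by (simp add: card_image card_Un_disjoint)
next
  case (4 c h)
  let ?D = "Cons (1, - 1) ` path_tails (Suc c) h"
  let ?U = "Cons (1, 1) ` path_tails c (Suc (Suc h))"
  let ?F = "Cons (2, 0) ` path_tails c (Suc h)"
  have "p \<in> path_tails (Suc c) (Suc h) \<longleftrightarrow> p \<in> ?D \<union> (?U \<union> ?F)" for p
    by (cases p) (auto simp: path_tails_Nil path_tails_Cons)
  then have "path_tails (Suc c) (Suc h) = ?D \<union> (?U \<union> ?F)" by blast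
  moreover have "?D \<inter> (?U \<union> ?F) = {}" and "?U \<inter> ?F = {}" by auto
  ultimately show ?case using 4 by (simp add: card_image card_Un_disjoint)
qed

lemma large_schroeder_path_tail_count: "large_schroeder m = path_tail_count m 0"
proof -
  have "schroeder_paths m = path_tails m 0"
    by (simp add: schroeder_paths_def path_tails_def)
  then show ?thesis
    using finite_card_path_tails[of m 0] by (simp add: large_schroeder_def)
qed

text \<open>The number of nodes \<open>d\<close> levels below a node labelled \<open>h\<close> in the tree where a node labelled \<open>h\<close>
  has children labelled \<open>1, ..., h, h + 1, h + 1\<close>.\<close>

fun tree_count :: "nat \<Rightarrow> nat \<Rightarrow> nat" where
  "tree_count 0 h = 1"
| "tree_count (Suc d) h = (\<Sum>j = 1..h. tree_count d j) + 2 * tree_count d (Suc h)"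

text \<open>The \<open>h\<close>-fold iterate of the operator \<open>f \<mapsto> (\<lambda>i. f i + f (i + 1))\<close>, that is, the sum of
  \<open>(h choose j) * f (i + j)\<close> over \<open>j\<close>, in the recursive form that the induction below needs.\<close>

primrec binomial_transform :: "(nat \<Rightarrow> nat) \<Rightarrow> nat \<Rightarrow> nat \<Rightarrow> nat" where
  "binomial_transform f 0 i = f i"
| "binomial_transform f (Suc h) i = binomial_transform f h i + binomial_transform f h (Suc i)"

lemma binomial_transform_path_tail_count_Suc:
  "binomial_transform (path_tail_count (Suc d)) h (Suc i) =
   binomial_transform (path_tail_count (Suc d)) h i + binomial_transform (path_tail_count d) (Suc h) (Suc i)"
  by (induction h arbitrary: i) (auto simp: algebra_simps)

lemma path_tail_count_0: "path_tail_count 0 h = 1"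
  by (induction h) auto

text \<open>This identity relates the generating tree to lattice paths. It can be guessed from generating
  functions: let \<open>Z\<close> be the series of the large Schroeder numbers. Tails from height \<open>h\<close> have the
  series \<open>Z ^ (h + 1)\<close>, as they split at the first visits of the heights below \<open>h\<close>, whereas the
  recursion of the tree is solved by \<open>Z * ((1 + Z) / 2) ^ h\<close>; expand the power. The proof compares
  the differences in \<open>h\<close> of both sides, where the recursion of the tree becomes linear with three
  terms.\<close>

lemma tree_count_binomial_transform:
  "2 ^ h * tree_count d h = binomial_transform (path_tail_count d) h 0"
proof (induction d arbitrary: h)
  case 0
  have "binomial_transform (path_tail_count 0) h i = 2 ^ h" for i
    by (induction h arbitrary: i) (auto simp: path_tail_count_0)
  then show ?case by simp
next
  case (Suc d)
  show ?case
  proof (induction h)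
    case 0
    show ?case using Suc.IH[of 1] by (simp add: algebra_simps)
  next
    case (Suc h)
    have rec: "tree_count (Suc d) (Suc h) + tree_count d (Suc h) =
        tree_count (Suc d) h + 2 * tree_count d (Suc (Suc h))"
      by simp
    let ?b = "binomial_transform (path_tail_count d)"
    let ?B = "binomial_transform (path_tail_count (Suc d))"
    have "?B (Suc h) 0 + ?b (Suc h) 0 = 2 * ?B h 0 + ?b (Suc (Suc h)) 0"
      using binomial_transform_path_tail_count_Suc[of d h 0] by simp
    also have "\<dots> = 2 ^ Suc h * (tree_count (Suc d) h + 2 * tree_count d (Suc (Suc h)))"
      unfolding Suc.IH[symmetric] \<open>\<And>h. 2 ^ h * tree_count d h = ?b h 0\<close>[symmetric]
      by (simp add: algebra_simps del: tree_count.simps)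
    also have "\<dots> = 2 ^ Suc h * tree_count (Suc d) (Suc h) + ?b (Suc h) 0"
      unfolding rec[symmetric] \<open>\<And>h. 2 ^ h * tree_count d h = ?b h 0\<close>[symmetric]
      by (simp add: algebra_simps del: tree_count.simps)
    finally show ?case by simp
  qed
qed

lemma tree_count_eq_large_schroeder: "tree_count m 0 = large_schroeder m"
  using tree_count_binomial_transform[of 0 m] by (simp add: large_schroeder_path_tail_count)

section \<open>Permutations avoiding 3124 and 2134\<close>

text \<open>No entry has larger entries on both sides. For distinct entries this means that the list first
  rises and then falls.\<close>

fun valley_free :: "nat list \<Rightarrow> bool" where
  "valley_free [] \<longleftrightarrow> True"
| "valley_free (d # ys) \<longleftrightarrow> sorted_wrt (\<lambda>c b. c < d \<longrightarrow> \<not> c < b) ys \<and> valley_free ys"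

lemma valley_free_nth:
  "valley_free ys \<longleftrightarrow>
    (\<forall>k<length ys. \<forall>j<k. \<forall>i<j. \<not> (ys ! j < ys ! i \<and> ys ! j < ys ! k))"
proof (induction ys)
  case (Cons d ys)
  show ?case (is "_ \<longleftrightarrow> ?R")
  proof
    assume L: "valley_free (d # ys)"
    show ?R
    proof (intro allI impI)
      fix i j k assume o: "k < length (d # ys)" "j < k" "i < j"
      obtain k' where k: "k = Suc k'" using o by (cases k) auto
      obtain j' where j: "j = Suc j'" using o by (cases j) auto
      have o': "k' < length ys" "j' < k'" using o j k by auto
      show "\<not> ((d # ys) ! j < (d # ys) ! i \<and> (d # ys) ! j < (d # ys) ! k)"
      proof (cases i)
        case 0
        have "sorted_wrt (\<lambda>c b. c < d \<longrightarrow> \<not> c < b) ys" using L by simp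
        then show ?thesis
          using sorted_wrt_nth_less[OF _ o'(2,1)] by (simp add: 0 j k)
      next
        case (Suc i')
        have "valley_free ys" using L by simp
        then show ?thesis
          using Cons.IH[THEN iffD1, rule_format, OF _ o', of i'] o by (simp add: Suc j k)
      qed
    qed
  next
    assume R: ?R
    have "\<not> (ys ! j < d \<and> ys ! j < ys ! k)" if "k < length ys" "j < k" for j k
      using R[rule_format, of "Suc k" "Suc j" 0] that by auto
    moreover have "\<not> (ys ! j < ys ! i \<and> ys ! j < ys ! k)" if "k < length ys" "j < k" "i < j" for i j k
      using R[rule_format, of "Suc k" "Suc j" "Suc i"] that by auto
    ultimately show "valley_free (d # ys)"
      by (simp add: Cons.IH sorted_wrt_iff_nth_less)
  qed
qed simp

lemma valley_free_rise:
  assumes "p < x"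
  shows "valley_free (p # x # t) \<longleftrightarrow> valley_free (x # t)"
proof -
  have "sorted_wrt (\<lambda>c b. c < p \<longrightarrow> \<not> c < b) t" if "sorted_wrt (\<lambda>c b. c < x \<longrightarrow> \<not> c < b) t"
    using that by (rule sorted_wrt_mono_rel[rotated]) (use assms in auto)
  then show ?thesis using assms by auto
qed

text \<open>Once the list has fallen it must fall forever: an entry after \<open>x\<close> that exceeds a predecessor
  back to \<open>x\<close> would make that predecessor a valley, as \<open>p\<close> is larger on its left.\<close>

lemma valley_free_fall:
  assumes "x < p" "distinct (x # t)"
  shows "valley_free (p # x # t) \<longleftrightarrow> sorted_wrt (>) (x # t)"
proof
  assume L: "valley_free (p # x # t)"
  then have "\<forall>b\<in>set t. b \<le> x"
    using assms(1) by auto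
  then have lt: "\<forall>b\<in>set t. b < x"
    using assms(2) by (metis distinct.simps(2) le_neq_implies_less)
  have "sorted_wrt (\<lambda>c b. c < p \<longrightarrow> \<not> c < b) t"
    using L by simp
  have "sorted_wrt (>) t"
    unfolding sorted_wrt_iff_nth_less
  proof (intro allI impI)
    fix i j assume ij: "i < j" "j < length t"
    then have "t ! i < p"
      using lt assms(1) by (metis less_trans nth_mem)
    then have "t ! j \<le> t ! i"
      using sorted_wrt_nth_less[OF \<open>sorted_wrt _ t\<close> ij] by simp
    moreover have "t ! i \<noteq> t ! j"
      using ij assms(2) by (simp add: nth_eq_iff_index_eq)
    ultimately show "t ! j < t ! i" by simp
  qed
  then show "sorted_wrt (>) (x # t)" using lt by simp
next
  assume R: "sorted_wrt (>) (x # t)"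
  have "valley_free ys" if "sorted_wrt (>) ys" for ys
    using that
  proof (induction ys)
    case (Cons y ys)
    then have "sorted_wrt (>) ys" by simp
    then have "sorted_wrt (\<lambda>c b. c < y \<longrightarrow> \<not> c < b) ys"
      by (rule sorted_wrt_mono_rel[rotated]) auto
    then show ?case using Cons by simp
  qed simp
  moreover have "sorted_wrt (>) (p # x # t)" using R assms by auto
  ultimately show "valley_free (p # x # t)" by blast
qed

fun fall_run :: "nat \<Rightarrow> nat list \<Rightarrow> nat" where
  "fall_run p [] = 0"
| "fall_run p (x # xs) = (if x < p then Suc (fall_run x xs) else 0)"

text \<open>With the starting entry \<open>p\<close> set apart, the length of the longest prefix that first rises and
  then falls. A single scan suffices, which turns the count of insertion places below into an
  induction on the list.\<close>

fun hill_run :: "nat \<Rightarrow> nat list \<Rightarrow> nat" where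
  "hill_run p [] = 0"
| "hill_run p (x # xs) = Suc (if p < x then hill_run x xs else fall_run x xs)"

lemma hill_run_le: "hill_run p xs \<le> length xs"
proof -
  have "fall_run p xs \<le> length xs" for p xs
    by (induction p xs rule: fall_run.induct) auto
  then show ?thesis
    by (induction p xs rule: hill_run.induct) auto
qed

lemma sorted_wrt_take_fall_run:
  "k \<le> length xs \<Longrightarrow> sorted_wrt (>) (p # take k xs) \<longleftrightarrow> k \<le> fall_run p xs"
proof (induction xs arbitrary: p k)
  case (Cons x xs)
  show ?case
  proof (cases k)
    case (Suc i)
    have "sorted_wrt (>) (p # x # take i xs) \<longleftrightarrow> x < p \<and> sorted_wrt (>) (x # take i xs)"
      by auto
    then show ?thesis using Suc Cons by auto
  qed simp
qed simp

text \<open>Hence the valley-free prefixes are exactly those that the scan has passed.\<close>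

lemma valley_free_take_hill_run:
  "distinct (p # xs) \<Longrightarrow> k \<le> length xs \<Longrightarrow>
    valley_free (p # take k xs) \<longleftrightarrow> k \<le> hill_run p xs"
proof (induction xs arbitrary: p k)
  case (Cons x xs)
  show ?case
  proof (cases k)
    case (Suc i)
    show ?thesis
    proof (cases "p < x")
      case True
      then show ?thesis
        using Suc Cons valley_free_rise[OF True, of "take i xs"] by (simp del: valley_free.simps)
    next
      case False
      then have "x < p" using Cons.prems by auto
      moreover have "distinct (x # take i xs)"
        using Cons.prems by (auto dest: in_set_takeD)
      ultimately have "valley_free (p # x # take i xs) \<longleftrightarrow> sorted_wrt (>) (x # take i xs)"
        by (rule valley_free_fall)
      then show ?thesis
        using Suc Cons.prems False sorted_wrt_take_fall_run[of i xs x]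
        by (simp del: valley_free.simps sorted_wrt.simps)
    qed
  qed simp
qed simp

definition insert_at :: "nat \<Rightarrow> 'a \<Rightarrow> 'a list \<Rightarrow> 'a list" where
  "insert_at p a xs = take p xs @ a # drop p xs"

lemma insert_at_simps [simp]:
  "insert_at 0 a xs = a # xs"
  "insert_at (Suc p) a (x # xs) = x # insert_at p a xs"
  by (simp_all add: insert_at_def)

lemma fall_run_insert_at:
  "\<forall>x\<in>set xs. x < m \<Longrightarrow> p < m \<Longrightarrow> k \<le> fall_run p xs \<Longrightarrow> fall_run p (insert_at k m xs) = k"
proof (induction xs arbitrary: p k)
  case (Cons x xs)
  then show ?case by (cases k) (auto split: if_splits)
qed (simp add: insert_at_def)

text \<open>Inserting a new maximum \<open>m\<close> into \<open>p # xs\<close> at the places within the valley-free prefix or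
  directly after it turns the label \<open>h = hill_run p xs\<close> into \<open>1, ..., h, h + 1, h + 1\<close>, in some
  order. Indeed, just before or just after the top of the prefix the new maximum becomes the top, and
  the prefix grows by one; further left the rise resumes after one falling step, so that the prefix
  ends there; further right it ends before the new maximum.
  This is expressed by summing an arbitrary \<open>g\<close> over the new labels, so that the induction can
  replace \<open>g\<close> by its shift. The first summand is the insertion in front of \<open>p\<close>.\<close>

lemma sum_hill_run_insert_at:
  fixes g :: "nat \<Rightarrow> nat"
  assumes "\<forall>x\<in>set (p # xs). x < m" "distinct (p # xs)"
  shows "g (Suc (fall_run p xs)) + (\<Sum>k\<le>hill_run p xs. g (hill_run p (insert_at k m xs))) =
    (\<Sum>j = 1..hill_run p xs. g j) + 2 * g (Suc (hill_run p xs))"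
  using assms
proof (induction xs arbitrary: p g)
  case Nil
  then show ?case by (simp add: insert_at_def)
next
  case (Cons x xs)
  show ?case
  proof (cases "p < x")
    case True
    have "g (Suc (fall_run p (x # xs))) +
        (\<Sum>k\<le>hill_run p (x # xs). g (hill_run p (insert_at k m (x # xs)))) =
      g 1 + (g (Suc (Suc (fall_run x xs))) +
        (\<Sum>k\<le>hill_run x xs. g (Suc (hill_run x (insert_at k m xs)))))"
      using True Cons.prems by (simp add: sum.atMost_Suc_shift del: sum.atMost_Suc)
    also have "\<dots> = g 1 + ((\<Sum>j = 1..hill_run x xs. g (Suc j)) + 2 * g (Suc (Suc (hill_run x xs))))"
      using Cons.IH[of x "\<lambda>j. g (Suc j)"] Cons.prems by simp
    also have "\<dots> = (\<Sum>j = 1..Suc (hill_run x xs). g j) + 2 * g (Suc (Suc (hill_run x xs)))"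
      by (subst (2) sum.atLeast_Suc_atMost)
        (simp_all add: sum.shift_bounds_cl_Suc_ivl del: sum.cl_ivl_Suc)
    finally show ?thesis using True by simp
  next
    case False
    then have "x < p" using Cons.prems by auto
    \<comment> \<open>within the falling part the new maximum ends the run right where it is inserted\<close>
    have "(\<Sum>k\<le>hill_run p (x # xs). g (hill_run p (insert_at k m (x # xs)))) =
        g (Suc (Suc (fall_run x xs))) +
        (\<Sum>k\<le>fall_run x xs. g (Suc (fall_run x (insert_at k m xs))))"
      using False Cons.prems by (simp add: sum.atMost_Suc_shift del: sum.atMost_Suc)
    also have "(\<Sum>k\<le>fall_run x xs. g (Suc (fall_run x (insert_at k m xs)))) =
        (\<Sum>k\<le>fall_run x xs. g (Suc k))"
      using Cons.prems by (intro sum.cong) (auto simp: fall_run_insert_at)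
    also have "\<dots> = (\<Sum>j = 1..Suc (fall_run x xs). g j)"
      by (simp add: sum.atLeast_Suc_atMost_Suc_shift atMost_atLeast0 del: sum.cl_ivl_Suc)
    finally show ?thesis
      using False \<open>x < p\<close> by simp
  qed
qed

text \<open>Of four entries from left to right, the second is never the smallest while the last is the
  largest: avoidance of the patterns 3124 and 2134.\<close>

definition avoids_patterns :: "nat list \<Rightarrow> bool" where
  "avoids_patterns xs \<longleftrightarrow> (\<forall>l<length xs. \<forall>k<l. \<forall>j<k. \<forall>i<j.
     \<not> (xs ! j < xs ! i \<and> xs ! j < xs ! k \<and> xs ! i < xs ! l \<and> xs ! k < xs ! l))"

lemma nth_insert_at_skip:
  "p \<le> length xs \<Longrightarrow> i < length xs \<Longrightarrow> insert_at p a xs ! (if i < p then i else Suc i) = xs ! i"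
  by (auto simp: insert_at_def nth_append min_def)

lemma nth_insert_at_same: "p \<le> length xs \<Longrightarrow> insert_at p a xs ! p = a"
  by (auto simp: insert_at_def nth_append min_def)

lemma length_insert_at [simp]: "length (insert_at p a xs) = Suc (length xs)"
  by (simp add: insert_at_def)

text \<open>A new maximum can only play the final 4 of a forbidden pattern, so what precedes it must not
  contain 312 or 213, that is, a valley.\<close>

lemma avoids_patterns_insert_at:
  assumes m: "\<forall>x\<in>set xs. x < m" and p: "p \<le> length xs"
  shows "avoids_patterns (insert_at p m xs) \<longleftrightarrow> avoids_patterns xs \<and> valley_free (take p xs)"
proof -
  let ?ys = "insert_at p m xs"
  \<comment> \<open>the place to which the insertion moves the entry at place \<open>i\<close>\<close>
  define s where "s = (\<lambda>i. if i < p then i else Suc i)"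
  have s: "?ys ! s i = xs ! i" if "i < length xs" for i
    using nth_insert_at_skip[OF p that] by (simp add: s_def)
  have ls: "?ys ! l = xs ! l" if "l < p" for l
    using s[of l] that p by (simp add: s_def)
  have last: "?ys ! p = m" using p by (rule nth_insert_at_same)
  have unskip: "\<exists>i'. i = s i'" if "i \<noteq> p" for i
  proof (cases "i < p")
    case True
    then have "i = s i" by (simp add: s_def)
    then show ?thesis ..
  next
    case False
    then have "i = s (i - 1)" using that by (auto simp: s_def)
    then show ?thesis ..
  qed
  have le: "?ys ! i \<le> m" if "i < length ?ys" for i
  proof (cases "i = p")
    case False
    then obtain i' where i': "i = s i'" using unskip by blast
    then have "i' < length xs" using that p by (auto simp: s_def split: if_splits)
    then show ?thesis using s[of i'] i' m nth_mem by fastforce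
  qed (simp add: last)
  have mono: "s i < s j \<longleftrightarrow> i < j" for i j by (auto simp: s_def)
  have len: "s i < length ?ys \<longleftrightarrow> i < length xs" for i using p by (auto simp: s_def)
  show ?thesis
  proof (intro iffI conjI)
    assume A: "avoids_patterns ?ys"
    show "avoids_patterns xs"
      unfolding avoids_patterns_def
    proof (intro allI impI)
      fix i j k l assume o: "l < length xs" "k < l" "j < k" "i < j"
      then have "?ys ! s l = xs ! l" "?ys ! s k = xs ! k" "?ys ! s j = xs ! j" "?ys ! s i = xs ! i"
        by (simp_all add: s)
      with o show "\<not> (xs ! j < xs ! i \<and> xs ! j < xs ! k \<and> xs ! i < xs ! l \<and> xs ! k < xs ! l)"
        using A[unfolded avoids_patterns_def, rule_format, of "s l" "s k" "s j" "s i"]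
        unfolding mono len by presburger
    qed
    show "valley_free (take p xs)"
      unfolding valley_free_nth
    proof (intro allI impI)
      fix i j k assume k: "k < length (take p xs)" "j < k" "i < j"
      then have "xs ! i < m" "xs ! k < m" using m by (auto intro: nth_mem)
      then show "\<not> (take p xs ! j < take p xs ! i \<and> take p xs ! j < take p xs ! k)"
        using A[unfolded avoids_patterns_def, rule_format, of p k j i] k p
        by (auto simp: last ls)
    qed
  next
    assume A: "avoids_patterns xs \<and> valley_free (take p xs)"
    show "avoids_patterns ?ys"
      unfolding avoids_patterns_def
    proof (intro allI impI notI)
      fix i j k l assume o: "l < length ?ys" "k < l" "j < k" "i < j"
        and v: "?ys ! j < ?ys ! i \<and> ?ys ! j < ?ys ! k \<and> ?ys ! i < ?ys ! l \<and> ?ys ! k < ?ys ! l"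
      show False
      proof (cases "l = p")
        case True
        then show False
          using A[THEN conjunct2, unfolded valley_free_nth, rule_format, of k j i] o v p
          by (auto simp: ls)
      next
        case False
        have "i \<noteq> p" "j \<noteq> p" "k \<noteq> p"
          using v o le[of l] le[of i] last by auto
        obtain i' where i: "i = s i'" using unskip[OF \<open>i \<noteq> p\<close>] ..
        obtain j' where j: "j = s j'" using unskip[OF \<open>j \<noteq> p\<close>] ..
        obtain k' where k: "k = s k'" using unskip[OF \<open>k \<noteq> p\<close>] ..
        obtain l' where l: "l = s l'" using unskip[OF False] ..
        note e = i j k l
        have o': "l' < length xs" "k' < l'" "j' < k'" "i' < j'"
          using o unfolding e mono len by blast+
        then have "?ys ! l = xs ! l'" "?ys ! k = xs ! k'" "?ys ! j = xs ! j'" "?ys ! i = xs ! i'"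
          unfolding e by (simp_all add: s)
        then show False
          using A[THEN conjunct1, unfolded avoids_patterns_def, rule_format, OF o'] v by simp
      qed
    qed
  qed
qed

definition avoiding_perms :: "nat \<Rightarrow> nat list set" where
  "avoiding_perms n = {xs. distinct xs \<and> set xs = {..<n} \<and> avoids_patterns xs}"

text \<open>One less than the length of the longest valley-free prefix, so that the single permutation of one
  element gets the label 0 of the root of the generating tree.\<close>

fun hill_label :: "nat list \<Rightarrow> nat" where
  "hill_label [] = 0"
| "hill_label (p # xs) = hill_run p xs"

text \<open>Every permutation arises uniquely by inserting its maximum, and the admissible places are those
  up to the end of the longest valley-free prefix.\<close>

lemma bij_betw_insert_at:
  assumes "n > 0"
  shows "bij_betw (\<lambda>(xs, p). insert_at p n xs)
    (SIGMA xs : avoiding_perms n. {..Suc (hill_label xs)}) (avoiding_perms (Suc n))"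
proof -
  have pos: "p \<le> length xs \<and> valley_free (take p xs) \<longleftrightarrow> p \<le> Suc (hill_label xs)"
    if "xs \<in> avoiding_perms n" for xs p
  proof -
    have "0 \<in> set xs"
      using that assms by (simp add: avoiding_perms_def)
    then obtain y ys where xs: "xs = y # ys"
      by (cases xs) auto
    have d: "distinct (y # ys)"
      using that unfolding avoiding_perms_def xs by blast
    show ?thesis
    proof (cases p)
      case (Suc k)
      show ?thesis
      proof (cases "k \<le> length ys")
        case True
        then show ?thesis
          using valley_free_take_hill_run[OF d True] by (simp add: Suc xs del: valley_free.simps)
      next
        case False
        then show ?thesis
          using hill_run_le[of y ys] by (simp add: Suc xs)
      qed
    qed simp
  qed
  have mem: "insert_at p n xs \<in> avoiding_perms (Suc n) \<longleftrightarrow>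
      xs \<in> avoiding_perms n \<and> valley_free (take p xs)"
    if p: "p \<le> length xs" and n: "n \<notin> set xs" for p xs
  proof -
    have split: "set xs = set (take p xs) \<union> set (drop p xs)"
      by (metis append_take_drop_id set_append)
    then have "set (insert_at p n xs) = insert n (set xs)"
      by (simp add: insert_at_def)
    then have "set (insert_at p n xs) = {..<Suc n} \<longleftrightarrow> set xs = {..<n}"
      using n by (simp add: lessThan_Suc insert_ident)
    moreover have "distinct (insert_at p n xs) \<longleftrightarrow> distinct xs"
    proof -
      have "distinct (us @ n # vs) \<longleftrightarrow> n \<notin> set us \<union> set vs \<and> distinct (us @ vs)" for us vs
        by auto
      from this[of "take p xs" "drop p xs"] show "distinct (insert_at p n xs) \<longleftrightarrow> distinct xs"
        using n unfolding insert_at_def append_take_drop_id split[symmetric] by blast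
    qed
    moreover have "avoids_patterns (insert_at p n xs) \<longleftrightarrow> avoids_patterns xs \<and> valley_free (take p xs)"
      if "set xs = {..<n}"
      using p that by (intro avoids_patterns_insert_at) auto
    ultimately show ?thesis
      unfolding avoiding_perms_def mem_Collect_eq by metis
  qed
  show ?thesis
    unfolding bij_betw_def
  proof
    show "inj_on (\<lambda>(xs, p). insert_at p n xs) (SIGMA xs : avoiding_perms n. {..Suc (hill_label xs)})"
      (is "inj_on ?f ?S")
    proof (rule inj_onI)
      fix z w assume zw: "z \<in> ?S" "w \<in> ?S" "?f z = ?f w"
      obtain xs p ys q where z: "z = (xs, p)" and w: "w = (ys, q)"
        by (metis surj_pair)
      have xs: "xs \<in> avoiding_perms n" "p \<in> {..Suc (hill_label xs)}"
        and ys: "ys \<in> avoiding_perms n" "q \<in> {..Suc (hill_label ys)}"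
        and eq: "insert_at p n xs = insert_at q n ys"
        using zw by (simp_all add: z w)
      have "n \<notin> set (take p xs) \<union> set (drop p xs) \<union> set (take q ys) \<union> set (drop q ys)"
        using xs ys by (auto simp: avoiding_perms_def dest!: in_set_takeD in_set_dropD)
      then have "take p xs = take q ys \<and> drop p xs = drop q ys"
        using eq append_Cons_eq_iff[of n "take p xs" "drop p xs" "take q ys" "drop q ys"]
        unfolding insert_at_def by blast
      moreover have "p \<le> length xs" "q \<le> length ys" using pos xs ys by auto
      ultimately show "z = w"
        unfolding z w by (metis append_take_drop_id length_take min.absorb2)
    qed
    show "(\<lambda>(xs, p). insert_at p n xs) ` (SIGMA xs : avoiding_perms n. {..Suc (hill_label xs)}) =
      avoiding_perms (Suc n)" (is "?f ` ?S = _")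
    proof
      show "?f ` ?S \<subseteq> avoiding_perms (Suc n)"
      proof (rule image_subsetI)
        fix z assume zS: "z \<in> ?S"
        obtain xs p where z: "z = (xs, p)" by (cases z)
        have xs: "xs \<in> avoiding_perms n" "p \<in> {..Suc (hill_label xs)}"
          using zS by (simp_all add: z)
        moreover have "n \<notin> set xs" using xs by (auto simp: avoiding_perms_def)
        ultimately show "?f z \<in> avoiding_perms (Suc n)"
          using pos[of xs p] mem[of p xs] by (simp add: z)
      qed
      show "avoiding_perms (Suc n) \<subseteq> ?f ` ?S"
      proof
        fix zs assume zs: "zs \<in> avoiding_perms (Suc n)"
        then have "n \<in> set zs" by (auto simp: avoiding_perms_def)
        then obtain us vs where uv: "zs = us @ n # vs" by (meson split_list)
        have zs': "zs = insert_at (length us) n (us @ vs)"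
          by (simp add: insert_at_def uv)
        moreover have "n \<notin> set (us @ vs)"
          using zs uv by (auto simp: avoiding_perms_def)
        ultimately have "us @ vs \<in> avoiding_perms n" "valley_free (take (length us) (us @ vs))"
          using zs mem[of "length us" "us @ vs"] by auto
        then have "(us @ vs, length us) \<in> ?S"
          using pos[of "us @ vs" "length us"] by auto
        then show "zs \<in> ?f ` ?S" using zs' by force
      qed
    qed
  qed
qed

lemma finite_avoiding_perms: "finite (avoiding_perms n)"
  by (rule finite_subset[OF _ finite_subset_distinct[of "{..<n}"]]) (auto simp: avoiding_perms_def)

lemma sum_hill_label_insert_at:
  assumes xs: "xs \<in> avoiding_perms n" and "n > 0"
  shows "(\<Sum>p\<le>Suc (hill_label xs). tree_count d (hill_label (insert_at p n xs))) =
    tree_count (Suc d) (hill_label xs)"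
proof -
  have "0 \<in> set xs"
    using assms by (simp add: avoiding_perms_def)
  then obtain y ys where y: "xs = y # ys"
    by (cases xs) auto
  have *: "\<forall>x\<in>set (y # ys). x < n" "distinct (y # ys)"
    using xs by (auto simp: avoiding_perms_def y)
  show ?thesis
    using sum_hill_run_insert_at[OF *, of "tree_count d"] *
    by (simp add: y sum.atMost_Suc_shift del: sum.atMost_Suc)
qed

text \<open>The avoiding permutations of size \<open>n + 1\<close> are the nodes at depth \<open>n\<close> of the generating tree;
  counting their descendants gives an invariant that passes from one level to the next.\<close>

lemma sum_tree_count_hill_label:
  "(\<Sum>xs\<in>avoiding_perms (Suc n). tree_count d (hill_label xs)) = tree_count (d + n) 0"
proof (induction n arbitrary: d)
  case 0
  have "xs = [0]" if "xs \<in> avoiding_perms (Suc 0)" for xs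
  proof -
    have d: "distinct xs" and s: "set xs = {0}"
      using that by (simp_all add: avoiding_perms_def lessThan_Suc)
    have "length xs = Suc 0"
      using distinct_card[OF d] by (simp add: s)
    then obtain x where "xs = [x]"
      by (auto simp: length_Suc_conv)
    then show ?thesis using s by simp
  qed
  moreover have "[0] \<in> avoiding_perms (Suc 0)"
    by (simp add: avoiding_perms_def avoids_patterns_def lessThan_Suc)
  ultimately have "avoiding_perms (Suc 0) = {[0]}" by blast
  then show ?case by simp
next
  case (Suc n)
  have "(\<Sum>xs\<in>avoiding_perms (Suc (Suc n)). tree_count d (hill_label xs)) =
    (\<Sum>(xs, p)\<in>(SIGMA xs : avoiding_perms (Suc n). {..Suc (hill_label xs)}).
       tree_count d (hill_label (insert_at p (Suc n) xs)))"
    by (subst sum.reindex_bij_betw[OF bij_betw_insert_at, symmetric]) (auto simp: case_prod_beta)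
  also have "\<dots> = (\<Sum>xs\<in>avoiding_perms (Suc n). \<Sum>p\<le>Suc (hill_label xs).
       tree_count d (hill_label (insert_at p (Suc n) xs)))"
    by (simp add: sum.Sigma finite_avoiding_perms del: sum.atMost_Suc)
  also have "\<dots> = (\<Sum>xs\<in>avoiding_perms (Suc n). tree_count (Suc d) (hill_label xs))"
    by (intro sum.cong refl sum_hill_label_insert_at) auto
  also have "\<dots> = tree_count (d + Suc n) 0"
    using Suc.IH[of "Suc d"] by simp
  finally show ?case .
qed

lemma card_avoiding_perms: "card (avoiding_perms (Suc n)) = large_schroeder n"
  using sum_tree_count_hill_label[where d = 0 and n = n]
  by (simp add: tree_count_eq_large_schroeder)

section \<open>Pairs of complementary orders as permutations\<close>

text \<open>For a strict linear order \<open>T\<close>, read as ``greater than'', this is the position of \<open>x\<close>.\<close>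

definition below_count :: "'a set \<Rightarrow> 'a rel \<Rightarrow> 'a \<Rightarrow> nat" where
  "below_count X T x = card {y \<in> X. (x, y) \<in> T}"

lemma below_count_iso:
  assumes "bij_betw \<xi> X Y" "x \<in> X"
    and T: "\<And>x y. x \<in> X \<Longrightarrow> y \<in> X \<Longrightarrow> (x, y) \<in> T \<longleftrightarrow> (\<xi> x, \<xi> y) \<in> U"
  shows "below_count Y U (\<xi> x) = below_count X T x"
proof -
  have "bij_betw \<xi> {y \<in> X. (x, y) \<in> T} {y \<in> Y. (\<xi> x, y) \<in> U}"
    unfolding bij_betw_def
  proof
    show "inj_on \<xi> {y \<in> X. (x, y) \<in> T}"
      by (rule inj_on_subset[OF bij_betw_imp_inj_on[OF assms(1)]]) simp
    show "\<xi> ` {y \<in> X. (x, y) \<in> T} = {y \<in> Y. (\<xi> x, y) \<in> U}"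
      using bij_betw_imp_surj_on[OF assms(1)] T[OF \<open>x \<in> X\<close>] by blast
  qed
  then show ?thesis
    by (simp add: below_count_def bij_betw_same_card)
qed

lemma below_count_linear_order:
  assumes "finite X" "trans T" "irrefl T"
    and total: "\<And>x y. x \<in> X \<Longrightarrow> y \<in> X \<Longrightarrow> x \<noteq> y \<Longrightarrow> (x, y) \<in> T \<or> (y, x) \<in> T"
  shows "bij_betw (below_count X T) X {..<card X}"
    and "x \<in> X \<Longrightarrow> y \<in> X \<Longrightarrow> below_count X T y < below_count X T x \<longleftrightarrow> (x, y) \<in> T"
proof -
  have mono: "below_count X T y < below_count X T x"
    if "x \<in> X" "y \<in> X" "(x, y) \<in> T" for x y
    unfolding below_count_def
  proof (rule psubset_card_mono)
    have "y \<notin> {z \<in> X. (y, z) \<in> T}" using \<open>irrefl T\<close> by (simp add: irrefl_def)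
    moreover have "{z \<in> X. (y, z) \<in> T} \<subseteq> {z \<in> X. (x, z) \<in> T}"
      using that(3) transD[OF \<open>trans T\<close>] by blast
    ultimately show "{z \<in> X. (y, z) \<in> T} \<subset> {z \<in> X. (x, z) \<in> T}"
      using that by blast
  qed (use \<open>finite X\<close> in simp)
  show iff: "below_count X T y < below_count X T x \<longleftrightarrow> (x, y) \<in> T"
    if "x \<in> X" "y \<in> X" for x y
    using mono[OF that] mono[OF that(2,1)] total[OF that] by fastforce
  have inj: "inj_on (below_count X T) X"
  proof (rule inj_onI)
    fix x y assume "x \<in> X" "y \<in> X" "below_count X T x = below_count X T y"
    then show "x = y"
      using mono[of x y] mono[of y x] total[of x y] by force
  qed
  have "below_count X T x < card X" if "x \<in> X" for x
    unfolding below_count_def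
  proof (rule psubset_card_mono[OF \<open>finite X\<close>])
    have "x \<notin> {z \<in> X. (x, z) \<in> T}" using \<open>irrefl T\<close> by (simp add: irrefl_def)
    then show "{z \<in> X. (x, z) \<in> T} \<subset> X" using that by blast
  qed
  then have "below_count X T ` X \<subseteq> {..<card X}" by blast
  moreover have "card (below_count X T ` X) = card {..<card X}"
    using card_image[OF inj] by simp
  ultimately show "bij_betw (below_count X T) X {..<card X}"
    using inj by (simp add: bij_betw_def card_subset_eq)
qed

text \<open>All axioms of \<^const>\<open>order_pairs\<close> but the one on compositions. What remains is invariant under
  reversing \<open>R\<close>, so that each result on \<open>S \<union> R\<close> also serves \<open>S \<union> R\<inverse>\<close>.\<close>

definition complementary_orders :: "'a set \<Rightarrow> 'a rel \<Rightarrow> 'a rel \<Rightarrow> bool" where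
  "complementary_orders X S R \<longleftrightarrow>
    strict_order_on X S \<and> strict_order_on X R \<and>
    sym_closure R \<union> sym_closure S = X \<times> X - Id_on X \<and>
    sym_closure R \<inter> sym_closure S = {}"

lemma complementary_orders_converse:
  "complementary_orders X S R \<Longrightarrow> complementary_orders X S (R\<inverse>)"
  by (auto simp: complementary_orders_def strict_order_on_def sym_closure_def irrefl_def)

text \<open>\<open>S \<union> R\<close> is a tournament. A cyclic triple would have two consecutive edges in one of the
  transitive relations \<open>S\<close> and \<open>R\<close>; thus there is none, and the tournament is transitive.\<close>

lemma complementary_orders_linear:
  assumes "complementary_orders X S R"
  shows "trans (S \<union> R)" and "irrefl (S \<union> R)"
    and "x \<in> X \<Longrightarrow> y \<in> X \<Longrightarrow> x \<noteq> y \<Longrightarrow> (x, y) \<in> S \<union> R \<or> (y, x) \<in> S \<union> R"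
proof -
  have tS: "trans S" and tR: "trans R" and iS: "irrefl S" and iR: "irrefl R"
    and SX: "S \<subseteq> X \<times> X" and RX: "R \<subseteq> X \<times> X"
    and un: "sym_closure R \<union> sym_closure S = X \<times> X - Id_on X"
    and dis: "sym_closure R \<inter> sym_closure S = {}"
    using assms by (simp_all add: complementary_orders_def strict_order_on_def)
  show total: "(x, y) \<in> S \<union> R \<or> (y, x) \<in> S \<union> R" if "x \<in> X" "y \<in> X" "x \<noteq> y" for x y
  proof -
    have "(x, y) \<in> sym_closure R \<union> sym_closure S"
      unfolding un using that by auto
    then show ?thesis by (auto simp: sym_closure_def)
  qed
  show "irrefl (S \<union> R)" using iS iR by (simp add: irrefl_def)
  have asym: "(y, x) \<notin> S \<union> R" if "(x, y) \<in> S \<union> R" for x y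
  proof
    assume yx: "(y, x) \<in> S \<union> R"
    have "\<not> ((x, y) \<in> S \<and> (y, x) \<in> S)" using transD[OF tS, of x y x] iS by (auto simp: irrefl_def)
    moreover have "\<not> ((x, y) \<in> R \<and> (y, x) \<in> R)"
      using transD[OF tR, of x y x] iR by (auto simp: irrefl_def)
    moreover have "\<not> ((x, y) \<in> S \<and> (y, x) \<in> R)" "\<not> ((x, y) \<in> R \<and> (y, x) \<in> S)"
      using dis by (auto simp: sym_closure_def)
    ultimately show False using that yx by blast
  qed
  show "trans (S \<union> R)"
  proof (rule transI)
    fix x y z assume xy: "(x, y) \<in> S \<union> R" and yz: "(y, z) \<in> S \<union> R"
    have X: "x \<in> X" "z \<in> X" using xy yz SX RX by blast+
    have xz: "x \<noteq> z" using asym[OF xy] yz by blast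
    have "(z, x) \<notin> S \<union> R"
    proof
      assume zx: "(z, x) \<in> S \<union> R"
      \<comment> \<open>two of the three edges of a cycle lie in the same order, which then contains the
        reverse of the third edge\<close>
      have "(x, z) \<notin> S \<union> R" "(z, y) \<notin> S \<union> R" "(y, x) \<notin> S \<union> R"
        by (fact asym[OF zx] asym[OF yz] asym[OF xy])+
      moreover note transD[OF tS, of x y z] transD[OF tS, of y z x] transD[OF tS, of z x y]
        transD[OF tR, of x y z] transD[OF tR, of y z x] transD[OF tR, of z x y]
      ultimately show False
        using xy yz zx unfolding Un_iff by argo
    qed
    then show "(x, z) \<in> S \<union> R" using total[OF X xz] by blast
  qed
qed

lemma order_pairs_2_1_iff:
  "(S, R) \<in> order_pairs 2 1 X \<longleftrightarrow> complementary_orders X S R \<and>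
    (\<forall>a b c d. (a, b) \<in> S \<longrightarrow> (b, c) \<in> S \<longrightarrow> (c, d) \<in> R \<longrightarrow> (a, d) \<in> R)"
proof -
  have "(S ^^ 2) O (R ^^ 1) \<subseteq> R \<longleftrightarrow>
      (\<forall>a b c d. (a, b) \<in> S \<longrightarrow> (b, c) \<in> S \<longrightarrow> (c, d) \<in> R \<longrightarrow> (a, d) \<in> R)"
    by (simp add: numeral_2_eq_2) blast
  then show ?thesis
    by (simp add: order_pairs_def complementary_orders_def)
qed

text \<open>The points \<open>e i\<close> are compared by their places \<open>i\<close> and by their values \<open>xs ! i\<close>. Both orders agree
  on \<open>S\<close> and disagree on \<open>R\<close>. The pairs point from later to earlier places and, in \<open>S\<close>, from larger to
  smaller values, so that the first element \<open>a\<close> of a violation \<open>a S b S c R d\<close> becomes the last and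
  largest entry of a forbidden pattern.\<close>

definition perm_pair :: "(nat \<Rightarrow> 'a) \<Rightarrow> nat list \<Rightarrow> 'a rel \<times> 'a rel" where
  "perm_pair e xs =
    ({(e i, e j) | i j. j < i \<and> i < length xs \<and> xs ! j < xs ! i},
     {(e i, e j) | i j. j < i \<and> i < length xs \<and> xs ! i < xs ! j})"

text \<open>These two statistics recover the place and the value of each point, and they are invariant
  under isomorphism.\<close>

definition pair_rank :: "'a set \<Rightarrow> 'a rel \<times> 'a rel \<Rightarrow> 'a \<Rightarrow> nat" where
  "pair_rank X P = below_count X (fst P \<union> snd P)"

definition pair_value :: "'a set \<Rightarrow> 'a rel \<times> 'a rel \<Rightarrow> 'a \<Rightarrow> nat" where
  "pair_value X P = below_count X (fst P \<union> (snd P)\<inverse>)"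

lemma pair_rank_value_iso:
  assumes "bij_betw \<xi> X Y" "x \<in> X"
    and "\<forall>x\<in>X. \<forall>y\<in>X. (x, y) \<in> fst P \<longleftrightarrow> (\<xi> x, \<xi> y) \<in> fst Q"
    and "\<forall>x\<in>X. \<forall>y\<in>X. (x, y) \<in> snd P \<longleftrightarrow> (\<xi> x, \<xi> y) \<in> snd Q"
  shows "pair_rank Y Q (\<xi> x) = pair_rank X P x" and "pair_value Y Q (\<xi> x) = pair_value X P x"
  unfolding pair_rank_def pair_value_def
  by (rule below_count_iso[OF assms(1,2)]; use assms(3,4) in auto)+

context
  fixes X :: "'a set" and e :: "nat \<Rightarrow> 'a" and n :: nat
  assumes e: "bij_betw e {..<n} X"
begin

lemma labelling_eq_iff: "i < n \<Longrightarrow> j < n \<Longrightarrow> e i = e j \<longleftrightarrow> i = j"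
  using bij_betw_imp_inj_on[OF e] by (auto simp: inj_on_eq_iff)

lemma perm_pair_iff:
  assumes "length xs = n" "i < n" "j < n"
  shows "(e i, e j) \<in> fst (perm_pair e xs) \<longleftrightarrow> j < i \<and> xs ! j < xs ! i"
    and "(e i, e j) \<in> snd (perm_pair e xs) \<longleftrightarrow> j < i \<and> xs ! i < xs ! j"
proof -
  have "(\<exists>i' j'. (e i, e j) = (e i', e j') \<and> j' < i' \<and> i' < length xs \<and> P i' j') \<longleftrightarrow> j < i \<and> P i j"
    for P
  proof
    assume "\<exists>i' j'. (e i, e j) = (e i', e j') \<and> j' < i' \<and> i' < length xs \<and> P i' j'"
    then obtain i' j' where *: "e i = e i'" "e j = e j'" "j' < i'" "i' < n" "P i' j'"
      using assms(1) by auto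
    then have "i = i'" "j = j'" using labelling_eq_iff assms by (metis less_trans)+
    then show "j < i \<and> P i j" using * by simp
  qed (use assms in blast)
  note * = this
  show "(e i, e j) \<in> fst (perm_pair e xs) \<longleftrightarrow> j < i \<and> xs ! j < xs ! i"
    "(e i, e j) \<in> snd (perm_pair e xs) \<longleftrightarrow> j < i \<and> xs ! i < xs ! j"
    unfolding perm_pair_def fst_conv snd_conv mem_Collect_eq
    by (rule *)+
qed

lemma perm_pair_subset:
  assumes "length xs = n"
  shows "fst (perm_pair e xs) \<subseteq> X \<times> X" and "snd (perm_pair e xs) \<subseteq> X \<times> X"
proof -
  have "e i \<in> X" if "i < n" for i
    using bij_betwE[OF e] that by simp
  then show "fst (perm_pair e xs) \<subseteq> X \<times> X" "snd (perm_pair e xs) \<subseteq> X \<times> X"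
    unfolding perm_pair_def using assms by auto
qed

lemma perm_pair_places:
  assumes "length xs = n" and "(x, y) \<in> fst (perm_pair e xs) \<or> (x, y) \<in> snd (perm_pair e xs)"
  obtains i j where "x = e i" "y = e j" "i < n" "j < n"
proof -
  from assms(2) show ?thesis
  proof
    assume "(x, y) \<in> fst (perm_pair e xs)"
    then show ?thesis using that assms(1) unfolding perm_pair_def by auto
  next
    assume "(x, y) \<in> snd (perm_pair e xs)"
    then show ?thesis using that assms(1) unfolding perm_pair_def by auto
  qed
qed

lemma perm_pair_trans:
  assumes "length xs = n"
  shows "trans (fst (perm_pair e xs))" "trans (snd (perm_pair e xs))"
proof -
  show "trans (fst (perm_pair e xs))"
  proof (rule transI)
    fix x y z assume a: "(x, y) \<in> fst (perm_pair e xs)" "(y, z) \<in> fst (perm_pair e xs)"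
    obtain i j where 1: "x = e i" "y = e j" "i < n" "j < n" by (rule perm_pair_places[OF assms disjI1[OF a(1)]])
    obtain k where 2: "z = e k" "k < n" by (rule perm_pair_places[OF assms disjI1[OF a(2)]])
    show "(x, z) \<in> fst (perm_pair e xs)"
      using a 1 2 by (simp add: perm_pair_iff[OF assms])
  qed
  show "trans (snd (perm_pair e xs))"
  proof (rule transI)
    fix x y z assume a: "(x, y) \<in> snd (perm_pair e xs)" "(y, z) \<in> snd (perm_pair e xs)"
    obtain i j where 1: "x = e i" "y = e j" "i < n" "j < n" by (rule perm_pair_places[OF assms disjI2[OF a(1)]])
    obtain k where 2: "z = e k" "k < n" by (rule perm_pair_places[OF assms disjI2[OF a(2)]])
    show "(x, z) \<in> snd (perm_pair e xs)"
      using a 1 2 by (simp add: perm_pair_iff[OF assms])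
  qed
qed

lemma mem_labelled_iff: "x \<in> X \<longleftrightarrow> (\<exists>i<n. x = e i)"
  using bij_betw_imp_surj_on[OF e] by auto

lemma complementary_orders_perm_pair:
  assumes d: "distinct xs" and n: "length xs = n"
  shows "complementary_orders X (fst (perm_pair e xs)) (snd (perm_pair e xs))"
proof -
  let ?S = "fst (perm_pair e xs)" and ?R = "snd (perm_pair e xs)"
  have irr: "irrefl ?S" "irrefl ?R"
    unfolding irrefl_def perm_pair_def using n by (auto simp: labelling_eq_iff)
  have neq: "xs ! i \<noteq> xs ! j" if "i < n" "j < n" "i \<noteq> j" for i j
    using that d n by (simp add: nth_eq_iff_index_eq)
  have sub: "sym_closure ?R \<subseteq> X \<times> X" "sym_closure ?S \<subseteq> X \<times> X"
    using perm_pair_subset[OF n] by (auto simp: sym_closure_def)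
  have sc: "(e i, e j) \<in> sym_closure ?S \<longleftrightarrow> i \<noteq> j \<and> (i < j \<longleftrightarrow> xs ! i < xs ! j)"
    "(e i, e j) \<in> sym_closure ?R \<longleftrightarrow> i \<noteq> j \<and> (i < j \<longleftrightarrow> xs ! j < xs ! i)"
    if "i < n" "j < n" for i j
    using that neq[of i j] by (auto simp: sym_closure_def perm_pair_iff[OF n])
  have "(x, y) \<in> sym_closure ?R \<union> sym_closure ?S \<longleftrightarrow> x \<noteq> y"
    "(x, y) \<notin> sym_closure ?R \<inter> sym_closure ?S" if h: "x \<in> X" "y \<in> X" for x y
  proof -
    obtain i j where ij: "x = e i" "y = e j" "i < n" "j < n" using h unfolding mem_labelled_iff by blast
    show "(x, y) \<in> sym_closure ?R \<union> sym_closure ?S \<longleftrightarrow> x \<noteq> y"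
      "(x, y) \<notin> sym_closure ?R \<inter> sym_closure ?S"
      using ij neq[of i j] by (auto simp: sc labelling_eq_iff)
  qed
  then have "sym_closure ?R \<union> sym_closure ?S = X \<times> X - Id_on X" "sym_closure ?R \<inter> sym_closure ?S = {}"
    using sub by (auto simp: Id_on_iff)
  then show ?thesis
    using irr perm_pair_trans[OF n] perm_pair_subset[OF n]
    by (simp add: complementary_orders_def strict_order_on_def)
qed

text \<open>A violation \<open>a S b S c R d\<close> without \<open>a R d\<close> forces \<open>a S d\<close>. In terms of places and values this
  is one of the forbidden patterns, at the places of \<open>d\<close>, \<open>c\<close>, \<open>b\<close>, \<open>a\<close> in this order.\<close>

lemma perm_pair_in_order_pairs:
  assumes xs: "xs \<in> avoiding_perms n"
  shows "perm_pair e xs \<in> order_pairs 2 1 X"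
proof -
  let ?S = "fst (perm_pair e xs)" and ?R = "snd (perm_pair e xs)"
  have d: "distinct xs" and set: "set xs = {..<n}" and av: "avoids_patterns xs"
    using xs by (simp_all add: avoiding_perms_def)
  have n: "length xs = n" using distinct_card[OF d] by (simp add: set)
  have "(a, d) \<in> ?R" if h: "(a, b) \<in> ?S" "(b, c) \<in> ?S" "(c, d) \<in> ?R" for a b c d
  proof -
    obtain l k where 1: "a = e l" "b = e k" "l < n" "k < n" by (rule perm_pair_places[OF n disjI1[OF h(1)]])
    obtain j i where 2: "c = e j" "d = e i" "j < n" "i < n" by (rule perm_pair_places[OF n disjI2[OF h(3)]])
    have o: "k < l" "j < k" "i < j" "xs ! k < xs ! l" "xs ! j < xs ! k" "xs ! j < xs ! i"
      using h 1 2 by (simp_all add: perm_pair_iff[OF n])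
    then have "\<not> xs ! i < xs ! l"
      using av 1 n unfolding avoids_patterns_def by blast
    moreover have "xs ! i \<noteq> xs ! l"
      using o 1 d n by (simp add: nth_eq_iff_index_eq)
    ultimately show ?thesis
      using o 1 2 by (simp add: perm_pair_iff[OF n])
  qed
  then have "(?S, ?R) \<in> order_pairs 2 1 X"
    using complementary_orders_perm_pair[OF d n] unfolding order_pairs_2_1_iff by blast
  then show ?thesis by simp
qed

lemma pair_rank_value_perm_pair:
  assumes xs: "xs \<in> avoiding_perms n" and i: "i < n"
  shows "pair_rank X (perm_pair e xs) (e i) = i"
    and "pair_value X (perm_pair e xs) (e i) = xs ! i"
proof -
  let ?S = "fst (perm_pair e xs)" and ?R = "snd (perm_pair e xs)"
  have d: "distinct xs" and set: "set xs = {..<n}"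
    using xs by (simp_all add: avoiding_perms_def)
  have n: "length xs = n" using distinct_card[OF d] by (simp add: set)
  have neq: "xs ! i \<noteq> xs ! j" if "i < n" "j < n" "i \<noteq> j" for i j
    using that d n by (simp add: nth_eq_iff_index_eq)
  have bc: "below_count X T (e i) = card {j. j < n \<and> (e i, e j) \<in> T}" for T
  proof -
    have "{y \<in> X. (e i, y) \<in> T} = e ` {j. j < n \<and> (e i, e j) \<in> T}"
      by (auto simp: mem_labelled_iff)
    moreover have "inj_on e {j. j < n \<and> (e i, e j) \<in> T}"
      by (rule inj_on_subset[OF bij_betw_imp_inj_on[OF e]]) auto
    ultimately show ?thesis by (simp add: below_count_def card_image)
  qed
  have "(e i, e j) \<in> ?S \<union> ?R \<longleftrightarrow> j < i" if "j < n" for j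
    using neq[OF i that] by (auto simp: perm_pair_iff[OF n] i that)
  then have "{j. j < n \<and> (e i, e j) \<in> ?S \<union> ?R} = {j. j < n \<and> j < i}"
    by blast
  also have "\<dots> = {..<i}" using i by auto
  finally show "pair_rank X (perm_pair e xs) (e i) = i"
    by (simp add: pair_rank_def bc)
  have "(e i, e j) \<in> ?S \<union> ?R\<inverse> \<longleftrightarrow> xs ! j < xs ! i" if "j < n" for j
    using neq[OF i that]
    by (cases i j rule: linorder_cases) (auto simp: perm_pair_iff[OF n] i that)
  then have "{j. j < n \<and> (e i, e j) \<in> ?S \<union> ?R\<inverse>} = {j. j < n \<and> xs ! j < xs ! i}"
    by blast
  moreover have "card {j. j < n \<and> xs ! j < xs ! i} = card {..<xs ! i}"
  proof (rule bij_betw_same_card[of "(!) xs"])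
    have "xs ! i < n" using nth_mem[of i xs] i n set by simp
    show "bij_betw ((!) xs) {j. j < n \<and> xs ! j < xs ! i} {..<xs ! i}"
      unfolding bij_betw_def
    proof
      show "inj_on ((!) xs) {j. j < n \<and> xs ! j < xs ! i}"
        using d n by (auto simp: inj_on_def nth_eq_iff_index_eq)
      have "\<exists>j<n. xs ! j = v" if "v < xs ! i" for v
      proof -
        have "v \<in> set xs" using that \<open>xs ! i < n\<close> by (simp add: set)
        then show ?thesis by (simp add: in_set_conv_nth n)
      qed
      then show "(!) xs ` {j. j < n \<and> xs ! j < xs ! i} = {..<xs ! i}"
        by (auto simp: image_iff; metis)
    qed
  qed
  ultimately show "pair_value X (perm_pair e xs) (e i) = xs ! i"
    by (simp add: pair_value_def bc)
qed

text \<open>An isomorphism preserves places, hence fixes every point, and preserves values.\<close>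

lemma perm_pair_iso_imp_eq:
  assumes xs: "xs \<in> avoiding_perms n" and ys: "ys \<in> avoiding_perms n"
    and iso: "pair_isomorphic X (perm_pair e xs) X (perm_pair e ys)"
  shows "xs = ys"
proof -
  obtain \<xi> where bij: "bij_betw \<xi> X X"
    and S: "\<forall>x\<in>X. \<forall>y\<in>X. (x, y) \<in> fst (perm_pair e xs) \<longleftrightarrow> (\<xi> x, \<xi> y) \<in> fst (perm_pair e ys)"
    and R: "\<forall>x\<in>X. \<forall>y\<in>X. (x, y) \<in> snd (perm_pair e xs) \<longleftrightarrow> (\<xi> x, \<xi> y) \<in> snd (perm_pair e ys)"
    using iso unfolding pair_isomorphic_def by blast
  have len: "length xs = n" "length ys = n"
    using xs ys distinct_card[of xs] distinct_card[of ys] by (simp_all add: avoiding_perms_def)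
  have "xs ! i = ys ! i" if i: "i < n" for i
  proof -
    have eX: "e i \<in> X" using i mem_labelled_iff by blast
    then have "\<xi> (e i) \<in> X" using bij_betwE[OF bij] by blast
    then obtain j where j: "j < n" "\<xi> (e i) = e j" using mem_labelled_iff by blast
    have "j = i"
      using pair_rank_value_iso(1)[OF bij eX S R]
      by (simp add: j pair_rank_value_perm_pair(1)[OF xs i] pair_rank_value_perm_pair(1)[OF ys])
    then show ?thesis
      using pair_rank_value_iso(2)[OF bij eX S R]
      by (simp add: j pair_rank_value_perm_pair(2)[OF xs i] pair_rank_value_perm_pair(2)[OF ys i] \<open>j = i\<close>)
  qed
  then show ?thesis using len by (simp add: list_eq_iff_nth_eq)
qed

text \<open>List the points by their position in the linear order \<open>S \<union> R\<close> and record their positions in the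
  linear order \<open>S \<union> R\<inverse>\<close>.\<close>

lemma order_pairs_iso_perm_pair:
  assumes P: "P \<in> order_pairs 2 1 X"
  obtains xs where "xs \<in> avoiding_perms n" "pair_isomorphic X P X (perm_pair e xs)"
proof -
  obtain S R where SR: "P = (S, R)" by (cases P)
  have co: "complementary_orders X S R"
    and cond: "\<And>a b c d. (a, b) \<in> S \<Longrightarrow> (b, c) \<in> S \<Longrightarrow> (c, d) \<in> R \<Longrightarrow> (a, d) \<in> R"
    using P unfolding SR order_pairs_2_1_iff by blast+
  have fin: "finite X" and card: "card X = n"
    using bij_betw_finite[OF e] bij_betw_same_card[OF e] by simp_all
  let ?p = "pair_rank X P" and ?v = "pair_value X P"
  note L = complementary_orders_linear[OF co]
    and L' = complementary_orders_linear[OF complementary_orders_converse[OF co]]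
  have p: "bij_betw ?p X {..<n}"
    unfolding pair_rank_def SR fst_conv snd_conv card[symmetric]
    by (rule below_count_linear_order(1)[OF fin L(1,2)]) (rule L(3))
  have v: "bij_betw ?v X {..<n}"
    unfolding pair_value_def SR fst_conv snd_conv card[symmetric]
    by (rule below_count_linear_order(1)[OF fin L'(1,2)]) (rule L'(3))
  have p_less: "?p y < ?p x \<longleftrightarrow> (x, y) \<in> S \<union> R" if "x \<in> X" "y \<in> X" for x y
    unfolding pair_rank_def SR fst_conv snd_conv
    by (rule below_count_linear_order(2)[OF fin L(1,2) _ that]) (rule L(3))
  have v_less: "?v y < ?v x \<longleftrightarrow> (x, y) \<in> S \<union> R\<inverse>" if "x \<in> X" "y \<in> X" for x y
    unfolding pair_value_def SR fst_conv snd_conv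
    by (rule below_count_linear_order(2)[OF fin L'(1,2) _ that]) (rule L'(3))
  have disj: "(x, y) \<notin> S \<or> (x, y) \<notin> R" "(x, y) \<notin> S \<or> (y, x) \<notin> R" for x y
    using co by (auto simp: complementary_orders_def sym_closure_def)
  have asym: "(x, y) \<notin> R \<or> (y, x) \<notin> R" for x y
    using co unfolding complementary_orders_def strict_order_on_def irrefl_def
    by (meson transD)
  have S_iff: "(x, y) \<in> S \<longleftrightarrow> ?p y < ?p x \<and> ?v y < ?v x"
    and R_iff: "(x, y) \<in> R \<longleftrightarrow> ?p y < ?p x \<and> ?v x < ?v y" if "x \<in> X" "y \<in> X" for x y
    using p_less[OF that] v_less[OF that] v_less[OF that(2,1)] disj[of x y] disj[of y x] asym[of x y]
    by auto
  define q where "q = inv_into X ?p"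
  have q: "q i \<in> X" "?p (q i) = i" if "i < n" for i
    using p that unfolding q_def
    by (auto intro!: inv_into_into f_inv_into_f simp: bij_betw_def)
  define xs where "xs = map (\<lambda>i. ?v (q i)) [0..<n]"
  have len: "length xs = n" by (simp add: xs_def)
  have nth: "xs ! i = ?v (q i)" if "i < n" for i using that by (simp add: xs_def)
  have nthp: "xs ! ?p x = ?v x" and pn: "?p x < n" if "x \<in> X" for x
  proof -
    show "?p x < n" using bij_betwE[OF p] that by blast
    moreover have "q (?p x) = x"
      unfolding q_def using that p by (simp add: bij_betw_def)
    ultimately show "xs ! ?p x = ?v x" by (simp add: nth)
  qed
  have "xs \<in> avoiding_perms n"
  proof -
    have "bij_betw q {..<n} X" unfolding q_def by (rule bij_betw_inv_into[OF p])
    then have vq: "bij_betw (?v \<circ> q) {..<n} {..<n}" using v by (rule bij_betw_trans)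
    have "distinct xs"
      using bij_betw_imp_inj_on[OF vq] by (simp add: xs_def distinct_map comp_def atLeast0LessThan)
    moreover have "set xs = {..<n}"
      using bij_betw_imp_surj_on[OF vq] by (simp add: xs_def comp_def atLeast0LessThan)
    moreover have "avoids_patterns xs"
      unfolding avoids_patterns_def
    proof (intro allI impI notI, elim conjE)
      fix i j k l
      assume o: "l < length xs" "k < l" "j < k" "i < j"
        and x: "xs ! j < xs ! i" "xs ! j < xs ! k" "xs ! i < xs ! l" "xs ! k < xs ! l"
      have b: "i < n" "j < n" "k < n" "l < n" using o len by simp_all
      have "(q l, q k) \<in> S" "(q k, q j) \<in> S" "(q j, q i) \<in> R"
        using x o b by (simp_all add: S_iff R_iff q nth)
      then have "(q l, q i) \<in> R" by (rule cond)
      then have "?v (q l) < ?v (q i)" using R_iff q b by blast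
      then show False using x(3) b by (simp add: nth)
    qed
    ultimately show ?thesis by (simp add: avoiding_perms_def)
  qed
  moreover have "pair_isomorphic X P X (perm_pair e xs)"
    unfolding pair_isomorphic_def
  proof (intro exI conjI ballI)
    show "bij_betw (e \<circ> ?p) X X" by (rule bij_betw_trans[OF p e])
    fix x y assume "x \<in> X" "y \<in> X"
    then show "(x, y) \<in> fst P \<longleftrightarrow> ((e \<circ> ?p) x, (e \<circ> ?p) y) \<in> fst (perm_pair e xs)"
      "(x, y) \<in> snd P \<longleftrightarrow> ((e \<circ> ?p) x, (e \<circ> ?p) y) \<in> snd (perm_pair e xs)"
      by (simp_all add: SR S_iff[unfolded SR] R_iff[unfolded SR] perm_pair_iff[OF len] pn[unfolded SR] nthp[unfolded SR])
  qed
  ultimately show thesis by (rule that)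
qed

end

lemma pair_isomorphic_sym:
  assumes "pair_isomorphic X P Y Q"
  shows "pair_isomorphic Y Q X P"
proof -
  obtain \<xi> where bij: "bij_betw \<xi> X Y"
    and S: "\<forall>x\<in>X. \<forall>y\<in>X. (x, y) \<in> fst P \<longleftrightarrow> (\<xi> x, \<xi> y) \<in> fst Q"
    and R: "\<forall>x\<in>X. \<forall>y\<in>X. (x, y) \<in> snd P \<longleftrightarrow> (\<xi> x, \<xi> y) \<in> snd Q"
    using assms unfolding pair_isomorphic_def by blast
  have inv: "inv_into X \<xi> y \<in> X" "\<xi> (inv_into X \<xi> y) = y" if "y \<in> Y" for y
    using that bij by (auto intro!: inv_into_into f_inv_into_f simp: bij_betw_def)
  show ?thesis
    unfolding pair_isomorphic_def
    by (rule exI[of _ "inv_into X \<xi>"]) (simp add: bij_betw_inv_into[OF bij] S R inv)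
qed

lemma pair_isomorphic_trans:
  assumes "pair_isomorphic X P Y Q" and "pair_isomorphic Y Q Z T"
  shows "pair_isomorphic X P Z T"
proof -
  obtain \<xi> where 1: "bij_betw \<xi> X Y"
    "\<forall>x\<in>X. \<forall>y\<in>X. (x, y) \<in> fst P \<longleftrightarrow> (\<xi> x, \<xi> y) \<in> fst Q"
    "\<forall>x\<in>X. \<forall>y\<in>X. (x, y) \<in> snd P \<longleftrightarrow> (\<xi> x, \<xi> y) \<in> snd Q"
    using assms(1) unfolding pair_isomorphic_def by blast
  obtain \<zeta> where 2: "bij_betw \<zeta> Y Z"
    "\<forall>x\<in>Y. \<forall>y\<in>Y. (x, y) \<in> fst Q \<longleftrightarrow> (\<zeta> x, \<zeta> y) \<in> fst T"
    "\<forall>x\<in>Y. \<forall>y\<in>Y. (x, y) \<in> snd Q \<longleftrightarrow> (\<zeta> x, \<zeta> y) \<in> snd T"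
    using assms(2) unfolding pair_isomorphic_def by blast
  have "\<xi> x \<in> Y" if "x \<in> X" for x using bij_betwE[OF 1(1)] that by blast
  then show ?thesis
    unfolding pair_isomorphic_def
    by (intro exI[of _ "\<zeta> \<circ> \<xi>"]) (simp add: bij_betw_trans[OF 1(1) 2(1)] 1 2)
qed

lemma pair_isomorphic_refl: "pair_isomorphic X P X P"
  unfolding pair_isomorphic_def by (rule exI[of _ id]) simp

lemma equiv_order_pairs_iso: "equiv (order_pairs h k X) (order_pairs_iso h k X)"
proof (rule equivI)
  show "refl_on (order_pairs h k X) (order_pairs_iso h k X)"
    by (auto simp: refl_on_def order_pairs_iso_def pair_isomorphic_refl)
  show "sym (order_pairs_iso h k X)"
    by (rule symI) (auto simp: order_pairs_iso_def intro: pair_isomorphic_sym)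
  show "trans (order_pairs_iso h k X)"
    by (rule transI) (auto simp: order_pairs_iso_def intro: pair_isomorphic_trans)
qed (auto simp: order_pairs_iso_def)

theorem corollary5p1:
  fixes X :: "'a set" and n :: nat
  assumes "n \<ge> 1" and "finite X" and "card X = n"
  shows "card (order_pairs 2 1 X // order_pairs_iso 2 1 X) = large_schroeder (n - 1)"
proof -
  obtain e where e: "bij_betw e {..<n} X"
    using ex_bij_betw_nat_finite[OF assms(2)] assms(3) by (auto simp: atLeast0LessThan)
  let ?A = "order_pairs 2 1 X" and ?E = "order_pairs_iso 2 1 X"
  note eqv = equiv_order_pairs_iso[of 2 1 X]
  have "bij_betw (\<lambda>xs. ?E `` {perm_pair e xs}) (avoiding_perms n) (?A // ?E)"
    unfolding bij_betw_def
  proof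
    show "inj_on (\<lambda>xs. ?E `` {perm_pair e xs}) (avoiding_perms n)"
    proof (rule inj_onI)
      fix xs ys assume xy: "xs \<in> avoiding_perms n" "ys \<in> avoiding_perms n"
        and eq: "?E `` {perm_pair e xs} = ?E `` {perm_pair e ys}"
      have "(perm_pair e xs, perm_pair e ys) \<in> ?E"
        using eq_equiv_class[OF eq eqv] perm_pair_in_order_pairs[OF e xy(2)] by blast
      then have "pair_isomorphic X (perm_pair e xs) X (perm_pair e ys)"
        by (simp add: order_pairs_iso_def)
      then show "xs = ys" by (rule perm_pair_iso_imp_eq[OF e xy])
    qed
    show "(\<lambda>xs. ?E `` {perm_pair e xs}) ` avoiding_perms n = ?A // ?E"
    proof
      show "(\<lambda>xs. ?E `` {perm_pair e xs}) ` avoiding_perms n \<subseteq> ?A // ?E"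
        using perm_pair_in_order_pairs[OF e] by (auto intro: quotientI)
      show "?A // ?E \<subseteq> (\<lambda>xs. ?E `` {perm_pair e xs}) ` avoiding_perms n"
      proof
        fix C assume "C \<in> ?A // ?E"
        then obtain P where P: "P \<in> ?A" "C = ?E `` {P}" by (rule quotientE)
        obtain xs where xs: "xs \<in> avoiding_perms n" "pair_isomorphic X P X (perm_pair e xs)"
          using order_pairs_iso_perm_pair[OF e P(1)] .
        have "(P, perm_pair e xs) \<in> ?E"
          using P(1) xs perm_pair_in_order_pairs[OF e xs(1)] by (simp add: order_pairs_iso_def)
        then have "C = ?E `` {perm_pair e xs}"
          using equiv_class_eq[OF eqv] P(2) by blast
        then show "C \<in> (\<lambda>xs. ?E `` {perm_pair e xs}) ` avoiding_perms n"
          using xs(1) by blast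
      qed
    qed
  qed
  then have "card (?A // ?E) = card (avoiding_perms n)"
    by (simp add: bij_betw_same_card)
  also have "\<dots> = large_schroeder (n - 1)"
    using card_avoiding_perms[of "n - 1"] assms(1) by simp
  finally show ?thesis .
qed

end
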